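(* Let $0<a,b<1$ and let $f(t)={}_2F_1(a,b;1;t)$, a solution of $t(1-t)f''+[1-(1+a+b)t]f'-abf=0$. Set $$F(t_1,t_2)=f(t_1)f(t_2)(1-t_1)^{(a+b)/2}(1-t_2)^{(a+b)/2},\qquad x=t_1+t_2-2,\qquad y=(1-t_1)(1-t_2).$$ Then $F$, as a function of $x$ and $y$, satisfies $$D_x^2F+2D_xD_yF-\frac1{x+y+1}D_xF+\frac{x}{x+y+1}D_yF+\frac{(2ab-a-b)x}{2(x+y+1)}F=0$$ and $$D_y^2F+\frac{2y}{x^2}D_xD_yF+\frac{y^2}{x^2(x+y+1)}D_xF+\frac{y-x-x^2}{x(x+y+1)}D_yF-\frac{(a+b)(a+b-2)(x^2+x)+(a-b)^2xy-(4ab-2a-2b)y}{4x(x+y+1)}F=0.$$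
   Context: ${}_2F_1$ is the Gauss hypergeometric series; $D_x=x\,\partial/\partial x$ and $D_y=y\,\partial/\partial y$. *)

theory Defs
  imports "HOL-Complex_Analysis.Complex_Analysis"
begin

definition gauss_2F1 :: "complex \<Rightarrow> complex \<Rightarrow> complex \<Rightarrow> complex \<Rightarrow> complex" where
  "gauss_2F1 a b c t = eval_fps (fps_hypergeo [a, b] [c] 1) t"

text \<open>On the unit disc \<open>1 - t\<close> has positive real part, so the power below is the
  holomorphic branch with value 1 at \<open>t = 0\<close>.\<close>

definition F_prod :: "real \<Rightarrow> real \<Rightarrow> complex \<Rightarrow> complex \<Rightarrow> complex" where
  "F_prod a b t1 t2 =
     gauss_2F1 (of_real a) (of_real b) 1 t1 * gauss_2F1 (of_real a) (of_real b) 1 t2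
     * (1 - t1) powr (of_real ((a + b) / 2)) * (1 - t2) powr (of_real ((a + b) / 2))"

text \<open>The open set of those \<open>(x, y)\<close> that come from a point \<open>(t1, t2)\<close> of the bidisc.\<close>

definition xy_domain :: "(complex \<times> complex) set" where
  "xy_domain = {(t1 + t2 - 2, (1 - t1) * (1 - t2)) | t1 t2. norm t1 < 1 \<and> norm t2 < 1}"

text \<open>Holomorphy in two variables: at every point of \<open>S\<close> (meant to be open) there is a
  complex linear total derivative.\<close>

definition holomorphic2_on :: "(complex \<Rightarrow> complex \<Rightarrow> complex) \<Rightarrow> (complex \<times> complex) set \<Rightarrow> bool" where
  "holomorphic2_on G S \<longleftrightarrow>
     (\<forall>p\<in>S. \<exists>A B. ((\<lambda>(x, y). G x y) has_derivative (\<lambda>(h, k). A * h + B * k)) (at p))"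

definition Dx :: "(complex \<Rightarrow> complex \<Rightarrow> complex) \<Rightarrow> complex \<Rightarrow> complex \<Rightarrow> complex" where
  "Dx G x y = x * deriv (\<lambda>u. G u y) x"

definition Dy :: "(complex \<Rightarrow> complex \<Rightarrow> complex) \<Rightarrow> complex \<Rightarrow> complex \<Rightarrow> complex" where
  "Dy G x y = y * deriv (\<lambda>v. G x v) y"

lemma gauss_2F1_conv_radius:
  assumes "0 < a" "a < 1" "0 < b" "b < 1"
  shows "fps_conv_radius (fps_hypergeo [complex_of_real a, of_real b] [1] 1) \<ge> 1"
proof -
  have poch: "0 \<le> pochhammer c n \<and> pochhammer c n \<le> fact n" if "0 < c" "c < 1" for c :: real and n
  proof (induction n)
    case (Suc n)
    have "pochhammer c n * (c + real n) \<le> fact n * (1 + real n)"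
      using Suc that by (intro mult_mono) auto
    with Suc that show ?case by (simp add: pochhammer_Suc algebra_simps)
  qed simp
  have nb: "norm (fps_nth (fps_hypergeo [complex_of_real a, of_real b] [1] 1) n) \<le> 1" for n
  proof -
    have "fps_nth (fps_hypergeo [complex_of_real a, of_real b] [1] 1) n
       = of_real (pochhammer a n * pochhammer b n / (fact n * fact n))"
      by (simp add: pochhammer_of_real pochhammer_fact[symmetric])
    moreover have "pochhammer a n * pochhammer b n \<le> fact n * fact n"
      using poch assms by (intro mult_mono) auto
    ultimately show ?thesis
      using poch[of a n] poch[of b n] assms by (simp add: norm_mult norm_divide)
  qed
  show ?thesis
    unfolding fps_conv_radius_def
  proof (rule conv_radius_geI_ex')
    fix r :: real assume r: "0 < r" "ereal r < 1"
    then have "summable (\<lambda>n. r ^ n)"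
      by (intro summable_geometric) (auto simp: one_ereal_def)
    then show "summable (\<lambda>n. fps_nth (fps_hypergeo [complex_of_real a, of_real b] [1] 1) n * of_real r ^ n)"
    proof (rule summable_comparison_test')
      fix n :: nat
      have "norm (fps_nth (fps_hypergeo [complex_of_real a, of_real b] [1] 1) n) * r ^ n \<le> 1 * r ^ n"
        using nb r by (intro mult_right_mono) auto
      then show "norm (fps_nth (fps_hypergeo [complex_of_real a, of_real b] [1] 1) n * of_real r ^ n) \<le> r ^ n"
        using r by (simp add: norm_mult norm_power del: fps_hypergeo_nth)
    qed
  qed
qed

lemma gauss_2F1_ode:
  assumes ab: "0 < a" "a < 1" "0 < b" "b < 1" and t: "norm t < 1"
  defines "f \<equiv> gauss_2F1 (complex_of_real a) (of_real b) 1"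
  shows "t * (1 - t) * deriv (deriv f) t + (1 - (1 + of_real a + of_real b) * t) * deriv f t
    - of_real a * of_real b * f t = 0"
proof -
  define H where "H = fps_hypergeo [complex_of_real a, of_real b] [1] 1"
  have r0: "fps_conv_radius H \<ge> 1"
    unfolding H_def by (rule gauss_2F1_conv_radius[OF ab])
  have r1: "fps_conv_radius (fps_deriv H) \<ge> 1"
    using r0 fps_conv_radius_deriv[of H] by (meson order_trans)
  have r2: "fps_conv_radius (fps_deriv (fps_deriv H)) \<ge> 1"
    using r1 fps_conv_radius_deriv[of "fps_deriv H"] by (meson order_trans)
  have lt: "ereal (norm u) < fps_conv_radius G" if "norm u < 1" "fps_conv_radius G \<ge> 1" for u G
    using that by (metis ereal_less(3) less_le_trans)
  have f: "f = eval_fps H"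
    by (simp add: f_def H_def gauss_2F1_def fun_eq_iff)
  have d1: "deriv f u = eval_fps (fps_deriv H) u" if "norm u < 1" for u
    unfolding f by (intro DERIV_imp_deriv has_field_derivative_eval_fps lt[OF that r0])
  have "deriv (deriv f) t = deriv (eval_fps (fps_deriv H)) t"
  proof (rule deriv_cong_ev)
    have "eventually (\<lambda>u. u \<in> ball 0 1) (nhds t)"
      using t by (intro eventually_nhds_in_open) auto
    then show "eventually (\<lambda>u. deriv f u = eval_fps (fps_deriv H) u) (nhds t)"
      by eventually_elim (use d1 in auto)
  qed simp
  also have "\<dots> = eval_fps (fps_deriv (fps_deriv H)) t"
    by (intro DERIV_imp_deriv has_field_derivative_eval_fps lt[OF t r1])
  finally have d2: "deriv (deriv f) t = eval_fps (fps_deriv (fps_deriv H)) t" .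
  have rec: "(of_nat n + of_real a) * (of_nat n + of_real b) * fps_nth H n = (of_nat n + 1)\<^sup>2 * fps_nth H (Suc n)" for n
  proof -
    have "complex_of_nat n + 1 \<noteq> 0"
      by (metis of_nat_Suc of_nat_neq_0 add.commute)
    moreover from this have "fact n + fact n * complex_of_nat n \<noteq> 0"
      by (metis add.commute distrib_left fact_nonzero mult.right_neutral mult_eq_0_iff)
    ultimately show ?thesis
      by (simp add: H_def pochhammer_Suc power2_eq_square pochhammer_fact[symmetric]
          divide_simps) (simp add: algebra_simps)
  qed
  define H1 H2 where "H1 = fps_deriv H" and "H2 = fps_deriv H1"
  have fps_ode: "fps_X * H2 + H1 = fps_X * (fps_X * H2) + fps_const (1 + of_real a + of_real b) * (fps_X * H1)
       + fps_const (of_real a * of_real b) * H"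
  proof (rule fps_ext)
    fix n
    show "fps_nth (fps_X * H2 + H1) n = fps_nth (fps_X * (fps_X * H2)
       + fps_const (1 + of_real a + of_real b) * (fps_X * H1) + fps_const (of_real a * of_real b) * H) n"
    proof (cases n)
      case 0
      then show ?thesis using rec[of 0] by (simp add: H1_def H2_def)
    next
      case (Suc m)
      have "fps_nth (fps_X * (fps_X * H2)) n = of_nat n * (of_nat n - 1) * fps_nth H n"
        unfolding Suc by (cases m) (simp_all add: H1_def H2_def algebra_simps)
      moreover have "fps_nth (fps_X * H2) n = of_nat n * (of_nat n + 1) * fps_nth H (Suc n)"
        unfolding Suc by (simp add: H1_def H2_def algebra_simps)
      moreover have "fps_nth (fps_X * H1) n = of_nat n * fps_nth H n"
        unfolding Suc by (simp add: H1_def)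
      moreover have "fps_nth H1 n = (of_nat n + 1) * fps_nth H (Suc n)"
        by (simp add: H1_def)
      ultimately show ?thesis
        using rec[of n]
        by (simp only: fps_add_nth fps_mult_left_const_nth) (simp add: algebra_simps power2_eq_square)
    qed
  qed
  define D where "D G \<longleftrightarrow> ereal (norm t) < fps_conv_radius G" for G :: "complex fps"
  have DX: "D fps_X" and DC: "D (fps_const c)" for c
    by (simp_all add: D_def)
  have DH: "D H" "D H1" "D H2"
    using lt[OF t] r0 r1 r2 by (auto simp: D_def H1_def H2_def)
  have Dm: "D (G * K)" and em: "eval_fps (G * K) t = eval_fps G t * eval_fps K t" if "D G" "D K" for G K
    using that fps_conv_radius_mult[of G K]
    by (auto simp: D_def eval_fps_mult elim!: order.strict_trans2[rotated])
  have Da: "D (G + K)" and ea: "eval_fps (G + K) t = eval_fps G t + eval_fps K t" if "D G" "D K" for G K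
    using that fps_conv_radius_add[of G K]
    by (auto simp: D_def eval_fps_add elim!: order.strict_trans2[rotated])
  have "t * eval_fps H2 t + eval_fps H1 t = t * (t * eval_fps H2 t)
      + (1 + of_real a + of_real b) * (t * eval_fps H1 t) + of_real a * of_real b * eval_fps H t"
    using arg_cong[OF fps_ode, of "\<lambda>G. eval_fps G t"]
    by (simp add: ea em Da Dm DX DC DH)
  then show ?thesis
    unfolding d2 d1[OF t] unfolding f H1_def H2_def by (simp add: algebra_simps)
qed

end

theory Submission
  imports Defs
begin

text \<open>Put \<open>g t = f t * (1 - t) powr ((a + b) / 2)\<close>, so that \<open>F = g t\<^sub>1 * g t\<^sub>2\<close> is symmetric in the roots of
  \<open>z\<^sup>2 + x z + y\<close> (where \<open>z = 1 - t\<close>). It is holomorphic in \<open>(x, y)\<close>, also across the diagonal \<open>t\<^sub>1 = t\<^sub>2\<close>: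
  \<open>2 * F = (g t\<^sub>1 + g t\<^sub>2)\<^sup>2 - (g t\<^sub>1\<^sup>2 + g t\<^sub>2\<^sup>2)\<close>, and by Cauchy's formula each power sum
  \<open>h t\<^sub>1 + h t\<^sub>2\<close> is the integral over a circle of \<open>h(w) * (2 w - x - 2) / ((1 - w)\<^sup>2 + x (1 - w) + y)\<close>,
  which can be differentiated under the integral sign. The linear equation for \<open>g\<close>, written in
  each of the two variables, gives two linear relations between the second-order partial
  derivatives in \<open>x\<close> and \<open>y\<close>. Eliminating one of these derivatives yields each of the two
  differential equations times \<open>t\<^sub>1 - t\<^sub>2\<close>, which settles the case \<open>t\<^sub>1 \<noteq> t\<^sub>2\<close>; the diagonal follows
  by continuity.\<close>

subsection \<open>Integrals of powers of a quadratic kernel\<close>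

text \<open>In the application \<open>z\<close> is \<open>1 - w\<close> with \<open>w\<close> on a
  circle, and \<open>nonzero\<close> says that the circle misses the two points \<open>t1\<close>,
  \<open>t2\<close> that belong to \<open>p = (x, y)\<close>.\<close>

locale quadratic_kernel =
  fixes z :: "real \<Rightarrow> complex" and U :: "(complex \<times> complex) set"
  assumes continuous_z: "continuous_on {0..1} z"
    and open_U: "open U"
    and nonzero: "\<And>p s. p \<in> U \<Longrightarrow> s \<in> {0..1} \<Longrightarrow> (z s)\<^sup>2 + fst p * z s + snd p \<noteq> 0"
begin

text \<open>The exponent is \<open>Suc k\<close> so that \<open>k = 0\<close> is the Cauchy kernel
  and each differentiation raises \<open>k\<close> by one.\<close>

definition kernel_integral :: "nat \<Rightarrow> (real \<Rightarrow> complex) \<Rightarrow> complex \<times> complex \<Rightarrow> complex" where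
  "kernel_integral k m p = integral {0..1} (\<lambda>s. m s / ((z s)\<^sup>2 + fst p * z s + snd p) ^ Suc k)"

lemma continuous_on_kernel:
  assumes "continuous_on {0..1} m"
  shows "continuous_on (U \<times> {0..1}) (\<lambda>(p, s). m s / ((z s)\<^sup>2 + fst p * z s + snd p) ^ Suc k)"
proof -
  have m: "continuous_on (U \<times> {0..1}) (\<lambda>q. m (snd q))" and z: "continuous_on (U \<times> {0..1}) (\<lambda>q. z (snd q))"
    by (auto intro!: continuous_on_compose2[OF assms] continuous_on_compose2[OF continuous_z] continuous_intros)
  show ?thesis
    unfolding case_prod_beta
    by (intro continuous_intros m z) (use nonzero in auto)
qed

lemma kernel_integrable:
  assumes "continuous_on {0..1} m" "p \<in> U"
  shows "(\<lambda>s. m s / ((z s)\<^sup>2 + fst p * z s + snd p) ^ Suc k) integrable_on {0..1}"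
proof (rule integrable_continuous_real)
  have "continuous_on {0..1} (\<lambda>s. (p, s))"
    by (intro continuous_intros)
  from continuous_on_compose2[OF continuous_on_kernel[OF assms(1), of k] this] assms(2)
  show "continuous_on {0..1} (\<lambda>s. m s / ((z s)\<^sup>2 + fst p * z s + snd p) ^ Suc k)"
    by auto
qed

text \<open>Differentiation under the integral sign: the power contributes
  \<open>- of_nat (Suc k)\<close>, and the inner derivative of the quadratic is \<open>z s\<close>
  in the first coordinate and \<open>1\<close> in the second.\<close>

lemma has_derivative_kernel_integral:
  assumes m: "continuous_on {0..1} m" and p: "p \<in> U"
  shows "(kernel_integral k m has_derivative
    (\<lambda>(u, v). kernel_integral (Suc k) (\<lambda>s. - of_nat (Suc k) * z s * m s) p * u
            + kernel_integral (Suc k) (\<lambda>s. - of_nat (Suc k) * m s) p * v)) (at p)"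
proof -
  \<comment> \<open>Leibniz's rule asks for a convex set of parameters, hence a ball inside
    \<open>U\<close>.\<close>
  obtain e where e: "e > 0" "ball p e \<subseteq> U"
    using open_U p by (meson openE)
  define Q where "Q q s = (z s)\<^sup>2 + fst q * z s + snd q" for q s
  define m1 m2 where "m1 s = - of_nat (Suc k) * z s * m s" and "m2 s = - of_nat (Suc k) * m s" for s
  have m12: "continuous_on {0..1} m1" "continuous_on {0..1} m2"
    unfolding m1_def m2_def by (intro continuous_intros m continuous_z)+
  \<comment> \<open>The rule takes the derivative of the integrand as a continuous family of bounded
    linear maps; \<open>fx q s\<close> sends \<open>(u, v)\<close> to the \<open>m1\<close> quotient
    times \<open>u\<close> plus the \<open>m2\<close> quotient times \<open>v\<close>.\<close>
  define A where "A j q s = blinfun_mult_right (j s / Q q s ^ Suc (Suc k))" for j q s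
  define fx where "fx q s = (A m1 q s o\<^sub>L fst_blinfun) + (A m2 q s o\<^sub>L snd_blinfun)" for q s
  have cA: "continuous_on (ball p e \<times> cbox 0 1) (\<lambda>(q, s). A j q s)" if "continuous_on {0..1} j" for j
    unfolding A_def Q_def case_prod_beta
    by (intro bounded_linear.continuous_on[OF bounded_linear_blinfun_mult_right]
         continuous_on_subset[OF continuous_on_kernel[OF that, of "Suc k", unfolded case_prod_beta]])
       (use e in auto)
  have "((\<lambda>q. integral (cbox 0 1) (\<lambda>s. m s / Q q s ^ Suc k)) has_derivative
          blinfun_apply (integral (cbox 0 1) (fx p))) (at p within ball p e)"
  proof (rule leibniz_rule[where fx = fx])
    fix q and s :: real assume q: "q \<in> ball p e" and s: "s \<in> cbox 0 1"
    have "Q q s \<noteq> 0"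
      using q s nonzero[of q s] e by (auto simp: Q_def)
    have "((\<lambda>X. X ^ Suc k) has_field_derivative of_nat (Suc k) * Q q s ^ k) (at (Q q s))"
      by (rule DERIV_cong[OF DERIV_power_Suc[OF DERIV_ident]]) simp
    from DERIV_divide[OF DERIV_const this, of "m s"]
    have "((\<lambda>X. m s / X ^ Suc k) has_field_derivative - of_nat (Suc k) * m s / Q q s ^ Suc (Suc k)) (at (Q q s))"
      using \<open>Q q s \<noteq> 0\<close> by (auto elim!: DERIV_cong simp: divide_simps simp del: of_nat_Suc)
    moreover have "((\<lambda>q. Q q s) has_derivative (\<lambda>h. fst h * z s + snd h)) (at q within ball p e)"
      unfolding Q_def by (auto intro!: derivative_eq_intros)
    ultimately have "((\<lambda>q. m s / Q q s ^ Suc k) has_derivative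
        (\<lambda>h. - of_nat (Suc k) * m s / Q q s ^ Suc (Suc k) * (fst h * z s + snd h))) (at q within ball p e)"
      unfolding has_field_derivative_def by (rule has_derivative_compose[rotated])
    then show "((\<lambda>q. m s / Q q s ^ Suc k) has_derivative blinfun_apply (fx q s)) (at q within ball p e)"
      by (rule has_derivative_eq_rhs)
         (auto simp: fun_eq_iff fx_def A_def m1_def m2_def blinfun.add_left algebra_simps add_divide_distrib
           diff_divide_distrib simp del: power_Suc of_nat_Suc)
  next
    fix q assume "q \<in> ball p e"
    then show "(\<lambda>s. m s / Q q s ^ Suc k) integrable_on cbox 0 1"
      using kernel_integrable[OF m, of q k] e by (auto simp: Q_def)
  next
    show "continuous_on (ball p e \<times> cbox 0 1) (\<lambda>(q, s). fx q s)"
      unfolding fx_def case_prod_beta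
      by (intro continuous_on_add bounded_bilinear.continuous_on[OF bounded_bilinear_blinfun_compose]
            continuous_on_const cA[OF m12(1), unfolded case_prod_beta] cA[OF m12(2), unfolded case_prod_beta])
  qed (use e in auto)
  moreover have "blinfun_apply (integral (cbox 0 1) (fx p)) =
    (\<lambda>(u, v). kernel_integral (Suc k) m1 p * u + kernel_integral (Suc k) m2 p * v)"
  proof -
    have "continuous_on (cbox 0 1) (\<lambda>s. fx p s)"
    proof -
      have "continuous_on (cbox 0 1) (\<lambda>s. A j p s)" if "continuous_on {0..1} j" for j
      proof -
        have "continuous_on (cbox 0 1) (\<lambda>s. (p, s :: real))"
          by (intro continuous_intros)
        from continuous_on_compose2[OF cA[OF that] this] show ?thesis
          using e by (simp add: image_subset_iff)
      qed
      note cAp = this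
      show ?thesis
        unfolding fx_def
        by (intro continuous_on_add bounded_bilinear.continuous_on[OF bounded_bilinear_blinfun_compose]
            continuous_on_const cAp m12)
    qed
    then have "fx p integrable_on cbox 0 1"
      by (rule integrable_continuous)
    note ap = blinfun_apply_integral[OF this, unfolded cbox_interval]
    have i: "(\<lambda>s. j s / Q p s ^ Suc (Suc k)) integrable_on {0..1}" if "continuous_on {0..1} j" for j
      using kernel_integrable[OF that p, of "Suc k"] by (simp add: Q_def)
    have "integral {0..1} (\<lambda>s. m1 s / Q p s ^ Suc (Suc k) * u + m2 s / Q p s ^ Suc (Suc k) * v)
       = kernel_integral (Suc k) m1 p * u + kernel_integral (Suc k) m2 p * v" for u v
      unfolding kernel_integral_def Q_def[symmetric]
      by (subst integral_add) (intro integrable_on_mult_left i m12 | simp only: integral_mult_left)+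
    then show ?thesis
      by (auto simp: fun_eq_iff ap fx_def A_def blinfun.add_left simp del: power_Suc)
  qed
  moreover have "(\<lambda>q. integral (cbox 0 1) (\<lambda>s. m s / Q q s ^ Suc k)) = kernel_integral k m"
    by (simp add: kernel_integral_def Q_def fun_eq_iff)
  ultimately show ?thesis
    using e by (simp add: at_within_open[of p "ball p e"] m1_def [abs_def] m2_def [abs_def] del: of_nat_Suc power_Suc)
qed

text \<open>The point of this class is that it is closed under partial derivatives, so that its
  members have continuous complex partial derivatives of all orders on \<open>U\<close>.\<close>

inductive kernel_algebra :: "(complex \<times> complex \<Rightarrow> complex) \<Rightarrow> bool" where
  const: "kernel_algebra (\<lambda>_. c)"
| fst: "kernel_algebra fst"
| integral: "continuous_on {0..1} m \<Longrightarrow> kernel_algebra (kernel_integral k m)"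
| add: "kernel_algebra \<phi> \<Longrightarrow> kernel_algebra \<psi> \<Longrightarrow> kernel_algebra (\<lambda>p. \<phi> p + \<psi> p)"
| mult: "kernel_algebra \<phi> \<Longrightarrow> kernel_algebra \<psi> \<Longrightarrow> kernel_algebra (\<lambda>p. \<phi> p * \<psi> p)"

text \<open>Kernel integrals yield kernel integrals of the next order; the other cases are the sum
  and product rules.\<close>

lemma kernel_algebra_derivative:
  assumes "kernel_algebra \<phi>"
  obtains A B where "kernel_algebra A" "kernel_algebra B"
    "\<And>p. p \<in> U \<Longrightarrow> (\<phi> has_derivative (\<lambda>(u, v). A p * u + B p * v)) (at p)"
proof -
  from assms have "\<exists>A B. kernel_algebra A \<and> kernel_algebra B \<and>
    (\<forall>p\<in>U. (\<phi> has_derivative (\<lambda>(u, v). A p * u + B p * v)) (at p))"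
  proof induction
    case (const c)
    show ?case
      by (intro exI[of _ "\<lambda>_. 0"]) (auto intro!: kernel_algebra.const derivative_eq_intros simp: case_prod_beta)
  next
    case fst
    show ?case
      by (rule exI[of _ "\<lambda>_. 1"], rule exI[of _ "\<lambda>_. 0"])
         (auto intro!: kernel_algebra.const derivative_eq_intros simp: case_prod_beta)
  next
    case (integral m k)
    show ?case
    proof (rule exI[of _ "kernel_integral (Suc k) (\<lambda>s. - of_nat (Suc k) * z s * m s)"],
          rule exI[of _ "kernel_integral (Suc k) (\<lambda>s. - of_nat (Suc k) * m s)"], intro conjI ballI)
      show "(kernel_integral k m has_derivative
        (\<lambda>(u, v). kernel_integral (Suc k) (\<lambda>s. - of_nat (Suc k) * z s * m s) p * u
                + kernel_integral (Suc k) (\<lambda>s. - of_nat (Suc k) * m s) p * v)) (at p)" if "p \<in> U" for p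
        by (rule has_derivative_kernel_integral[OF integral that])
    qed (intro kernel_algebra.integral continuous_intros continuous_z integral)+
  next
    case (add \<phi> \<psi>)
    then obtain A B C D where alg: "kernel_algebra A" "kernel_algebra B" "kernel_algebra C" "kernel_algebra D"
      and d: "\<And>p. p \<in> U \<Longrightarrow> (\<phi> has_derivative (\<lambda>(u, v). A p * u + B p * v)) (at p)"
        "\<And>p. p \<in> U \<Longrightarrow> (\<psi> has_derivative (\<lambda>(u, v). C p * u + D p * v)) (at p)"
      by blast
    show ?case
    proof (rule exI[of _ "\<lambda>p. A p + C p"], rule exI[of _ "\<lambda>p. B p + D p"], intro conjI ballI kernel_algebra.add alg)
      fix p assume "p \<in> U"
      from has_derivative_add[OF d[OF this]]
      show "((\<lambda>p. \<phi> p + \<psi> p) has_derivative (\<lambda>(u, v). (A p + C p) * u + (B p + D p) * v)) (at p)"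
        by (rule has_derivative_eq_rhs) (auto simp: fun_eq_iff algebra_simps)
    qed
  next
    case (mult \<phi> \<psi>)
    then obtain A B C D where alg: "kernel_algebra A" "kernel_algebra B" "kernel_algebra C" "kernel_algebra D"
      and d: "\<And>p. p \<in> U \<Longrightarrow> (\<phi> has_derivative (\<lambda>(u, v). A p * u + B p * v)) (at p)"
        "\<And>p. p \<in> U \<Longrightarrow> (\<psi> has_derivative (\<lambda>(u, v). C p * u + D p * v)) (at p)"
      by blast
    show ?case
    proof (rule exI[of _ "\<lambda>p. \<phi> p * C p + A p * \<psi> p"], rule exI[of _ "\<lambda>p. \<phi> p * D p + B p * \<psi> p"], intro conjI ballI
        kernel_algebra.add kernel_algebra.mult alg mult.hyps)
      fix p assume "p \<in> U"
      from has_derivative_mult[OF d[OF this]]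
      show "((\<lambda>p. \<phi> p * \<psi> p) has_derivative
        (\<lambda>(u, v). (\<phi> p * C p + A p * \<psi> p) * u + (\<phi> p * D p + B p * \<psi> p) * v)) (at p)"
        by (rule has_derivative_eq_rhs) (auto simp: fun_eq_iff algebra_simps)
    qed
  qed
  then show ?thesis
    using that by blast
qed

end

subsection \<open>Symmetric functions of two points of a disc\<close>

text \<open>For \<open>r = 1\<close> this is \<open>xy_domain\<close>. With \<open>r < 1\<close> the
  circle of radius \<open>r\<close> lies in the unit disc and encloses both \<open>t1\<close> and
  \<open>t2\<close>.\<close>

definition symmetric_image :: "real \<Rightarrow> (complex \<times> complex) set" where
  "symmetric_image r = {(t1 + t2 - 2, (1 - t1) * (1 - t2)) | t1 t2. norm t1 < r \<and> norm t2 < r}"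

text \<open>Quadratic formula: \<open>1 - t1\<close> and \<open>1 - t2\<close> are the roots of
  \<open>z\<^sup>2 + x * z + y\<close>.\<close>

lemma obtain_symmetric_coordinates:
  fixes x y :: complex
  obtains t1 t2 where "x = t1 + t2 - 2" "y = (1 - t1) * (1 - t2)"
proof
  let ?d = "csqrt (x\<^sup>2 - 4 * y)"
  have "?d * ?d = x\<^sup>2 - 4 * y"
    by (metis power2_csqrt power2_eq_square)
  then show "y = (1 - (1 + (x + ?d) / 2)) * (1 - (1 + (x - ?d) / 2))"
    by (simp add: field_simps power2_eq_square)
qed (simp add: field_simps)

text \<open>With \<open>\<alpha> = |t\<^sub>1|\<^sup>2\<close> and \<open>\<beta> = |t\<^sub>2|\<^sup>2\<close>, the parallelogram law expresses \<open>2 * (\<alpha> + \<beta>)\<close> through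
  \<open>t\<^sub>1 + t\<^sub>2\<close> and the discriminant \<open>x\<^sup>2 - 4 * y = (t\<^sub>1 - t\<^sub>2)\<^sup>2\<close>, and \<open>\<alpha> * \<beta> = |x + y + 1|\<^sup>2\<close>. The two
  inequalities say \<open>\<alpha> + \<beta> < 2 * r\<^sup>2\<close> and \<open>(r\<^sup>2 - \<alpha>) * (r\<^sup>2 - \<beta>) > 0\<close>.\<close>

lemma symmetric_image_iff:
  assumes "0 < r"
  shows "(x, y) \<in> symmetric_image r \<longleftrightarrow>
    (norm (x + 2))\<^sup>2 + norm (x\<^sup>2 - 4 * y) < 4 * r\<^sup>2 \<and>
    0 < r ^ 4 - r\<^sup>2 * ((norm (x + 2))\<^sup>2 + norm (x\<^sup>2 - 4 * y)) / 2 + (norm (x + y + 1))\<^sup>2"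
    (is "_ \<longleftrightarrow> ?R x y")
proof -
  have R: "?R (t1 + t2 - 2) ((1 - t1) * (1 - t2)) \<longleftrightarrow> norm t1 < r \<and> norm t2 < r" for t1 t2 :: complex
  proof -
    define \<alpha> \<beta> where "\<alpha> = (norm t1)\<^sup>2" and "\<beta> = (norm t2)\<^sup>2"
    have "(t1 + t2 - 2)\<^sup>2 - 4 * ((1 - t1) * (1 - t2)) = (t1 - t2)\<^sup>2"
      "t1 + t2 - 2 + (1 - t1) * (1 - t2) + 1 = t1 * t2"
      by (simp_all add: algebra_simps power2_eq_square)
    moreover have "(norm (t1 + t2))\<^sup>2 + (norm (t1 - t2))\<^sup>2 = 2 * \<alpha> + 2 * \<beta>"
      unfolding \<alpha>_def \<beta>_def cmod_power2 by (simp add: algebra_simps power2_eq_square)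
    ultimately have "?R (t1 + t2 - 2) ((1 - t1) * (1 - t2)) \<longleftrightarrow>
        2 * \<alpha> + 2 * \<beta> < 4 * r\<^sup>2 \<and> 0 < r ^ 4 - r\<^sup>2 * (2 * \<alpha> + 2 * \<beta>) / 2 + \<alpha> * \<beta>"
      by (simp add: norm_power norm_mult power_mult_distrib \<alpha>_def \<beta>_def)
    also have "\<dots> \<longleftrightarrow> \<alpha> + \<beta> < 2 * r\<^sup>2 \<and> 0 < (r\<^sup>2 - \<alpha>) * (r\<^sup>2 - \<beta>)"
      by (auto simp: algebra_simps power2_eq_square power4_eq_xxxx)
    \<comment> \<open>A positive product gives both factors the same sign, and the bound on the sum
      excludes two negative ones.\<close>
    also have "\<dots> \<longleftrightarrow> \<alpha> < r\<^sup>2 \<and> \<beta> < r\<^sup>2"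
      by (auto simp: zero_less_mult_iff)
    also have "\<dots> \<longleftrightarrow> norm t1 < r \<and> norm t2 < r"
      using assms power_strict_mono[of _ r 2] power2_less_imp_less[of _ r] unfolding \<alpha>_def \<beta>_def by auto
    finally show ?thesis .
  qed
  show ?thesis
  proof
    show "?R x y" if "(x, y) \<in> symmetric_image r"
      using that R unfolding symmetric_image_def by blast
  next
    assume "?R x y"
    obtain t1 t2 where t: "x = t1 + t2 - 2" "y = (1 - t1) * (1 - t2)"
      by (rule obtain_symmetric_coordinates)
    with \<open>?R x y\<close> R[of t1 t2] show "(x, y) \<in> symmetric_image r"
      unfolding symmetric_image_def by blast
  qed
qed

text \<open>The map from \<open>(t1, t2)\<close> is branched along the diagonal, so openness is read
  off the description by strict inequalities between continuous functions of \<open>x\<close> and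
  \<open>y\<close>.\<close>

lemma open_symmetric_image:
  assumes "0 < r"
  shows "open (symmetric_image r)"
proof -
  have "symmetric_image r =
    {p. (norm (fst p + 2))\<^sup>2 + norm ((fst p)\<^sup>2 - 4 * snd p) < 4 * r\<^sup>2} \<inter>
    {p. 0 < r ^ 4 - r\<^sup>2 * ((norm (fst p + 2))\<^sup>2 + norm ((fst p)\<^sup>2 - 4 * snd p)) / 2
              + (norm (fst p + snd p + 1))\<^sup>2}"
    using symmetric_image_iff[OF assms] by auto
  then show ?thesis
    by (auto intro!: open_Int open_Collect_less continuous_intros)
qed

text \<open>The integrand of the summed Cauchy formulas depends on the two points only through
  \<open>x\<close> and \<open>y\<close>; no square root is chosen, so the diagonal is not
  exceptional.\<close>

lemma symmetric_sum_kernel_integral: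
  fixes r :: real
  defines "w \<equiv> circlepath 0 r"
  assumes h: "h holomorphic_on ball 0 1" and r: "0 < r" "r < 1"
  assumes K: "quadratic_kernel (\<lambda>s. 1 - w s) (symmetric_image r)"
  obtains \<phi> where "quadratic_kernel.kernel_algebra (\<lambda>s. 1 - w s) \<phi>"
    "\<And>t1 t2. norm t1 < r \<Longrightarrow> norm t2 < r \<Longrightarrow> \<phi> (t1 + t2 - 2, (1 - t1) * (1 - t2)) = h t1 + h t2"
proof -
  interpret quadratic_kernel "\<lambda>s. 1 - w s" "symmetric_image r"
    by (rule K)
  define w' where "w' s = 2 * of_real pi * \<i> * r * exp (2 * of_real pi * \<i> * of_real s)" for s :: real
  \<comment> \<open>The numerator \<open>2 * w - x - 2\<close> contains \<open>x\<close>, while a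
    weight of a kernel integral may depend on \<open>s\<close> only. It is therefore split as
    \<open>m1 + x * m2\<close>, each weight carrying \<open>h\<close>, the speed \<open>w'\<close>
    of the circle and the factor \<open>1 / (2 * pi * \<i>)\<close>.\<close>
  define m2 where "m2 s = - h (w s) * w' s / (2 * of_real pi * \<i>)" for s
  define m1 where "m1 s = m2 s * (2 - 2 * w s)" for s
  have nw: "norm (w s) = r" for s
    using r by (simp add: w_def circlepath norm_mult norm_exp_eq_Re)
  have "continuous_on {0..1} w"
    by (auto simp: w_def circlepath intro!: continuous_intros)
  moreover have "continuous_on {0..1} (\<lambda>s. h (w s))"
    using nw r by (intro continuous_on_compose2[OF holomorphic_on_imp_continuous_on[OF h] \<open>continuous_on {0..1} w\<close>]) auto
  ultimately have m: "continuous_on {0..1} m1" "continuous_on {0..1} m2"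
    unfolding m1_def m2_def w'_def by (auto intro!: continuous_intros)
  define \<phi> where "\<phi> p = kernel_integral 0 m1 p + fst p * kernel_integral 0 m2 p" for p
  show ?thesis
  proof
    show "kernel_algebra \<phi>"
      unfolding \<phi>_def by (intro kernel_algebra.intros m)
  next
    fix t1 t2 :: complex assume t: "norm t1 < r" "norm t2 < r"
    define p where "p = (t1 + t2 - 2, (1 - t1) * (1 - t2))"
    have p: "p \<in> symmetric_image r"
      using t by (auto simp: p_def symmetric_image_def)
    have hol: "h holomorphic_on cball 0 r"
      using h by (rule holomorphic_on_subset) (use r in auto)
    have "((\<lambda>u. h u / (u - t1) + h u / (u - t2)) has_contour_integral
        2 * of_real pi * \<i> * h t1 + 2 * of_real pi * \<i> * h t2) w"
      unfolding w_def by (intro has_contour_integral_add Cauchy_integral_circlepath_simple hol) (use t in auto)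
    then have I: "((\<lambda>s. (h (w s) / (w s - t1) + h (w s) / (w s - t2)) * w' s / (2 * of_real pi * \<i>)) has_integral
        (2 * of_real pi * \<i> * h t1 + 2 * of_real pi * \<i> * h t2) / (2 * of_real pi * \<i>)) {0..1}"
      by (intro has_integral_divide) (simp add: has_contour_integral w_def vector_derivative_circlepath w'_def)
    have "\<phi> p = integral {0..1} (\<lambda>s. m1 s / ((1 - w s)\<^sup>2 + fst p * (1 - w s) + snd p) ^ Suc 0
        + fst p * (m2 s / ((1 - w s)\<^sup>2 + fst p * (1 - w s) + snd p) ^ Suc 0))"
      unfolding \<phi>_def kernel_integral_def
      by (subst integral_add) (intro integrable_on_mult_right kernel_integrable m p | simp only: integral_mult_right)+
    also have "\<dots> = integral {0..1} (\<lambda>s. (h (w s) / (w s - t1) + h (w s) / (w s - t2)) * w' s / (2 * of_real pi * \<i>))"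
    proof (rule integral_cong)
      fix s
      have ne: "w s - t1 \<noteq> 0" "w s - t2 \<noteq> 0"
        using nw[of s] t by auto
      have Q: "(1 - w s)\<^sup>2 + fst p * (1 - w s) + snd p = (w s - t1) * (w s - t2)"
        by (simp add: p_def algebra_simps power2_eq_square)
      show "m1 s / ((1 - w s)\<^sup>2 + fst p * (1 - w s) + snd p) ^ Suc 0
        + fst p * (m2 s / ((1 - w s)\<^sup>2 + fst p * (1 - w s) + snd p) ^ Suc 0)
        = (h (w s) / (w s - t1) + h (w s) / (w s - t2)) * w' s / (2 * of_real pi * \<i>)"
        unfolding Q m1_def m2_def using ne by (simp add: divide_simps p_def) (simp add: algebra_simps)
    qed
    also have "\<dots> = h t1 + h t2"
      using integral_unique[OF I] by (simp add: add_divide_distrib)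
    finally show "\<phi> (t1 + t2 - 2, (1 - t1) * (1 - t2)) = h t1 + h t2"
      by (simp add: p_def)
  qed
qed

text \<open>Cauchy's formula yields sums only, so the product is built from the sums for
  \<open>g\<close> and for its square. Both use the same circle and thus lie in the same
  \<open>kernel_algebra\<close>.\<close>

lemma symmetric_product_kernel_algebra:
  assumes g: "g holomorphic_on ball 0 1" and r: "0 < r" "r < 1"
  obtains z \<phi> where "quadratic_kernel z (symmetric_image r)" "quadratic_kernel.kernel_algebra z \<phi>"
    "\<And>t1 t2. norm t1 < r \<Longrightarrow> norm t2 < r \<Longrightarrow> \<phi> (t1 + t2 - 2, (1 - t1) * (1 - t2)) = g t1 * g t2"
proof -
  define w where "w = circlepath 0 r"
  have K: "quadratic_kernel (\<lambda>s. 1 - w s) (symmetric_image r)"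
  proof
    show "continuous_on {0..1} (\<lambda>s. 1 - w s)"
      by (auto simp: w_def circlepath intro!: continuous_intros)
  next
    fix p and s :: real assume "p \<in> symmetric_image r"
    then obtain t1 t2 where p: "p = (t1 + t2 - 2, (1 - t1) * (1 - t2))" and t: "norm t1 < r" "norm t2 < r"
      by (auto simp: symmetric_image_def)
    have "norm (w s) = r"
      using r by (simp add: w_def circlepath norm_mult norm_exp_eq_Re)
    moreover have "(1 - w s)\<^sup>2 + fst p * (1 - w s) + snd p = (w s - t1) * (w s - t2)"
      by (simp add: p algebra_simps power2_eq_square)
    ultimately show "(1 - w s)\<^sup>2 + fst p * (1 - w s) + snd p \<noteq> 0"
      using t by auto
  qed (rule open_symmetric_image[OF r(1)])
  interpret quadratic_kernel "\<lambda>s. 1 - w s" "symmetric_image r"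
    by (rule K)
  have "(\<lambda>t. g t * g t) holomorphic_on ball 0 1"
    by (intro holomorphic_intros g)
  from symmetric_sum_kernel_integral[OF this r K[unfolded w_def]]
  obtain \<psi> where \<psi>: "kernel_algebra \<psi>"
    "\<And>t1 t2. norm t1 < r \<Longrightarrow> norm t2 < r \<Longrightarrow> \<psi> (t1 + t2 - 2, (1 - t1) * (1 - t2)) = g t1 * g t1 + g t2 * g t2"
    unfolding w_def by blast
  from symmetric_sum_kernel_integral[OF g r K[unfolded w_def]]
  obtain \<phi> where \<phi>: "kernel_algebra \<phi>"
    "\<And>t1 t2. norm t1 < r \<Longrightarrow> norm t2 < r \<Longrightarrow> \<phi> (t1 + t2 - 2, (1 - t1) * (1 - t2)) = g t1 + g t2"
    unfolding w_def by blast
  show ?thesis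
  proof (rule that[OF K])
    \<comment> \<open>The difference is spelled with the constant \<open>- 1\<close> because the
      class is generated by constants, sums and products.\<close>
    show "kernel_algebra (\<lambda>p. 1 / 2 * (\<phi> p * \<phi> p + - 1 * \<psi> p))"
      by (intro kernel_algebra.intros \<phi> \<psi>)
    show "1 / 2 * (\<phi> (t1 + t2 - 2, (1 - t1) * (1 - t2)) * \<phi> (t1 + t2 - 2, (1 - t1) * (1 - t2))
        + - 1 * \<psi> (t1 + t2 - 2, (1 - t1) * (1 - t2))) = g t1 * g t2"
      if "norm t1 < r" "norm t2 < r" for t1 t2
      unfolding \<phi>(2)[OF that] \<psi>(2)[OF that] by (simp add: field_simps)
  qed
qed

text \<open>The principal square root is discontinuous, but a change of its sign merely swaps the
  two factors.\<close>

definition symmetric_product :: "(complex \<Rightarrow> complex) \<Rightarrow> complex \<Rightarrow> complex \<Rightarrow> complex" where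
  "symmetric_product g x y =
     g (1 + (x + csqrt (x\<^sup>2 - 4 * y)) / 2) * g (1 + (x - csqrt (x\<^sup>2 - 4 * y)) / 2)"

lemma symmetric_product_eq:
  "symmetric_product g (t1 + t2 - 2) ((1 - t1) * (1 - t2)) = g t1 * g t2"
proof -
  define d where "d = csqrt ((t1 + t2 - 2)\<^sup>2 - 4 * ((1 - t1) * (1 - t2)))"
  have "d\<^sup>2 = (t1 - t2)\<^sup>2"
    unfolding d_def power2_csqrt by (simp add: algebra_simps power2_eq_square)
  then have "d = t1 - t2 \<or> d = t2 - t1"
    by (auto simp: power2_eq_iff)
  then show ?thesis
  proof
    assume "d = t1 - t2"
    then have "1 + (t1 + t2 - 2 + d) / 2 = t1" "1 + (t1 + t2 - 2 - d) / 2 = t2"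
      by (simp_all add: field_simps)
    then show ?thesis
      unfolding symmetric_product_def d_def[symmetric] by simp
  next
    assume "d = t2 - t1"
    then have "1 + (t1 + t2 - 2 + d) / 2 = t2" "1 + (t1 + t2 - 2 - d) / 2 = t1"
      by (simp_all add: field_simps)
    then show ?thesis
      unfolding symmetric_product_def d_def[symmetric] by simp
  qed
qed

subsection \<open>Partial derivatives in symmetric coordinates\<close>

lemma DERIV_partial:
  assumes "((\<lambda>(x, y). G x y) has_derivative (\<lambda>(u, v). C * u + D * v)) (at (x, y))"
  shows "((\<lambda>u. G u y) has_field_derivative C) (at x)" "((\<lambda>v. G x v) has_field_derivative D) (at y)"
proof -
  have "((\<lambda>u. (u, y)) has_derivative (\<lambda>h. (h, 0))) (at x)" "((\<lambda>v. (x, v)) has_derivative (\<lambda>h. (0, h))) (at y)"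
    by (auto intro!: derivative_eq_intros)
  from this[THEN has_derivative_compose] assms
  have "((\<lambda>u. G u y) has_derivative (\<lambda>h. C * h)) (at x)" "((\<lambda>v. G x v) has_derivative (\<lambda>h. D * h)) (at y)"
    by fastforce+
  then show "((\<lambda>u. G u y) has_field_derivative C) (at x)" "((\<lambda>v. G x v) has_field_derivative D) (at y)"
    by (auto simp: has_field_derivative_def)
qed

lemma eventually_section:
  assumes "open U" "(x, y) \<in> U"
  shows "eventually (\<lambda>u. (u, y) \<in> U) (nhds x)" "eventually (\<lambda>v. (x, v) \<in> U) (nhds y)"
proof -
  have "open ((\<lambda>u. (u, y)) -` U)" "open ((\<lambda>v. (x, v)) -` U)"
    by (intro open_vimage assms(1) continuous_intros)+
  from this[THEN eventually_nhds_in_open] assms(2)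
  show "eventually (\<lambda>u. (u, y) \<in> U) (nhds x)" "eventually (\<lambda>v. (x, v) \<in> U) (nhds y)"
    by auto
qed

text \<open>Here \<open>si = 1 - ti\<close>, and \<open>gi\<close>, \<open>di\<close>,
  \<open>ei\<close> are the values of \<open>g\<close> and its first two derivatives at
  \<open>ti\<close>; \<open>M\<close> is the mixed partial derivative. Multiplying the equation at
  one point by the value of \<open>g\<close> at the other turns it into a linear relation between
  \<open>AA\<close>, \<open>M\<close> and \<open>BB\<close>.\<close>

lemma eliminate_second_derivatives:
  fixes s1 s2 :: complex
  assumes E1: "A - s2 * B = d1 * g2" and E2: "A - s1 * B = d2 * g1"
    and E3: "AA - s2 * (M + M) + s2\<^sup>2 * BB = e1 * g2"
    and E4: "AA - s1 * (M + M) + s1\<^sup>2 * BB = e2 * g1"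
    and O1: "(1 - s1) * s1\<^sup>2 * e1 + s1\<^sup>2 * d1 + (c - c\<^sup>2 * (1 - s1) - q * s1) * g1 = 0"
    and O2: "(1 - s2) * s2\<^sup>2 * e2 + s2\<^sup>2 * d2 + (c - c\<^sup>2 * (1 - s2) - q * s2) * g2 = 0"
    and x: "x = - (s1 + s2)" and y: "y = s1 * s2" and "s1 \<noteq> s2"
  shows "(x + y + 1) * (A + x * AA + 2 * y * M) - A + y * B + (q - c) * (g1 * g2) = 0"
    and "(x + y + 1) * (x * y * (B + y * BB) + 2 * y\<^sup>2 * M) + y\<^sup>2 * A + (y - x - x\<^sup>2) * y * B
       - (c * (c - 1) * (x\<^sup>2 + x) + (c\<^sup>2 - q) * x * y - (q - c) * y) * (g1 * g2) = 0"
proof -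
  have O1': "(1 - s1) * s1\<^sup>2 * (AA - s2 * (M + M) + s2\<^sup>2 * BB) + s1\<^sup>2 * (A - s2 * B)
      + (c - c\<^sup>2 * (1 - s1) - q * s1) * (g1 * g2) = 0"
    using arg_cong[OF O1, of "\<lambda>u. u * g2"] unfolding E1 E3 by (simp add: algebra_simps)
  have O2': "(1 - s2) * s2\<^sup>2 * (AA - s1 * (M + M) + s1\<^sup>2 * BB) + s2\<^sup>2 * (A - s1 * B)
      + (c - c\<^sup>2 * (1 - s2) - q * s2) * (g1 * g2) = 0"
    using arg_cong[OF O2, of "\<lambda>u. u * g1"] unfolding E2 E4 by (simp add: algebra_simps)
  \<comment> \<open>The left side is \<open>(1 - s1)\<close> times that of \<open>O2'\<close> minus
    \<open>(1 - s2)\<close> times that of \<open>O1'\<close>, which cancels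
    \<open>BB\<close>.\<close>
  have "(s1 - s2) * ((x + y + 1) * (A + x * AA + 2 * y * M) - A + y * B + (q - c) * (g1 * g2)) = 0"
    using O1' O2' unfolding x y by algebra
  then show "(x + y + 1) * (A + x * AA + 2 * y * M) - A + y * B + (q - c) * (g1 * g2) = 0"
    using \<open>s1 \<noteq> s2\<close> by simp
  \<comment> \<open>The left side is \<open>(1 - s2) * s2\<^sup>2\<close> times that of
    \<open>O1'\<close> minus \<open>(1 - s1) * s1\<^sup>2\<close> times that of \<open>O2'\<close>,
    which cancels \<open>AA\<close>.\<close>
  have "(s1 - s2) * ((x + y + 1) * (x * y * (B + y * BB) + 2 * y\<^sup>2 * M) + y\<^sup>2 * A + (y - x - x\<^sup>2) * y * B
       - (c * (c - 1) * (x\<^sup>2 + x) + (c\<^sup>2 - q) * x * y - (q - c) * y) * (g1 * g2)) = 0"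
    using O1' O2' unfolding x y by algebra
  then show "(x + y + 1) * (x * y * (B + y * BB) + 2 * y\<^sup>2 * M) + y\<^sup>2 * A + (y - x - x\<^sup>2) * y * B
       - (c * (c - 1) * (x\<^sup>2 + x) + (c\<^sup>2 - q) * x * y - (q - c) * y) * (g1 * g2) = 0"
    using \<open>s1 \<noteq> s2\<close> by simp
qed

text \<open>The coefficient pairs are \<open>A = \<Phi>\<^sub>x\<close>, \<open>B = \<Phi>\<^sub>y\<close>, \<open>AA = \<Phi>\<^sub>x\<^sub>x\<close>, \<open>AB = (\<Phi>\<^sub>x)\<^sub>y\<close>,
  \<open>BA = (\<Phi>\<^sub>y)\<^sub>x\<close>, \<open>BB = \<Phi>\<^sub>y\<^sub>y\<close>; equality of the mixed partials is not assumed.\<close>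

locale symmetric_jet =
  fixes g :: "complex \<Rightarrow> complex" and U :: "(complex \<times> complex) set"
    and \<Phi> A B AA AB BA BB :: "complex \<times> complex \<Rightarrow> complex"
  assumes holomorphic_g: "g holomorphic_on ball 0 1"
    and open_U: "open U"
    and \<Phi>_eq: "\<And>s t. norm s < 1 \<Longrightarrow> norm t < 1 \<Longrightarrow> (s + t - 2, (1 - s) * (1 - t)) \<in> U
           \<Longrightarrow> \<Phi> (s + t - 2, (1 - s) * (1 - t)) = g s * g t"
    and derivative_\<Phi>: "\<And>p. p \<in> U \<Longrightarrow> (\<Phi> has_derivative (\<lambda>(u, v). A p * u + B p * v)) (at p)"
    and derivative_A: "\<And>p. p \<in> U \<Longrightarrow> (A has_derivative (\<lambda>(u, v). AA p * u + AB p * v)) (at p)"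
    and derivative_B: "\<And>p. p \<in> U \<Longrightarrow> (B has_derivative (\<lambda>(u, v). BA p * u + BB p * v)) (at p)"
    and continuous_second: "continuous_on U AA" "continuous_on U BA" "continuous_on U BB"
begin

abbreviation P where "P s t \<equiv> (s + t - 2 :: complex, (1 - s) * (1 - t))"

definition V where "V = {(s, t). norm s < 1 \<and> norm t < 1 \<and> P s t \<in> U}"

lemma V_swap: "(s, t) \<in> V \<longleftrightarrow> (t, s) \<in> V"
  by (auto simp: V_def algebra_simps)

lemma P_swap: "P s t = P t s"
  by (simp add: algebra_simps)

lemma V_imp_U: "(s, t) \<in> V \<Longrightarrow> P s t \<in> U"
  by (simp add: V_def)

lemma eventually_V:
  assumes "(s, t) \<in> V"
  shows "eventually (\<lambda>s'. (s', t) \<in> V) (nhds s)" "eventually (\<lambda>t'. (s, t') \<in> V) (nhds t)"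
proof -
  have "open ((\<lambda>s. P s t) -` U)" "open ((\<lambda>t. P s t) -` U)"
    by (intro open_vimage open_U continuous_intros)+
  moreover have "{s'. (s', t) \<in> V} = ball 0 1 \<inter> (\<lambda>s. P s t) -` U"
    "{t'. (s, t') \<in> V} = ball 0 1 \<inter> (\<lambda>t. P s t) -` U"
    using assms by (auto simp: V_def)
  ultimately have "open {s'. (s', t) \<in> V}" "open {t'. (s, t') \<in> V}"
    by auto
  then show "eventually (\<lambda>s'. (s', t) \<in> V) (nhds s)" "eventually (\<lambda>t'. (s, t') \<in> V) (nhds t)"
    using assms by (auto dest: eventually_nhds_in_open)
qed

lemma DERIV_compose_P:
  assumes "(\<phi> has_derivative (\<lambda>(u, v). C * u + D * v)) (at (P s t))"
  shows "((\<lambda>s. \<phi> (P s t)) has_field_derivative C - (1 - t) * D) (at s)"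
    "((\<lambda>t. \<phi> (P s t)) has_field_derivative C - (1 - s) * D) (at t)"
proof -
  have "((\<lambda>s. P s t) has_derivative (\<lambda>h. (h, - h * (1 - t)))) (at s)"
    "((\<lambda>t. P s t) has_derivative (\<lambda>h. (h, - h * (1 - s)))) (at t)"
    by (auto intro!: derivative_eq_intros simp: fun_eq_iff algebra_simps)
  from this[THEN has_derivative_compose] assms
  have "((\<lambda>s. \<phi> (P s t)) has_derivative (\<lambda>h. C * h + D * (- h * (1 - t)))) (at s)"
    "((\<lambda>t. \<phi> (P s t)) has_derivative (\<lambda>h. C * h + D * (- h * (1 - s)))) (at t)"
    by fastforce+
  then show "((\<lambda>s. \<phi> (P s t)) has_field_derivative C - (1 - t) * D) (at s)"
    "((\<lambda>t. \<phi> (P s t)) has_field_derivative C - (1 - s) * D) (at t)"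
    unfolding has_field_derivative_def by (auto elim!: has_derivative_eq_rhs simp: fun_eq_iff algebra_simps)
qed

lemma
  assumes "norm s < 1"
  shows DERIV_g: "(g has_field_derivative deriv g s) (at s)"
    and DERIV_g': "(deriv g has_field_derivative deriv (deriv g) s) (at s)"
  using assms holomorphic_g by (auto intro!: holomorphic_derivI[of _ "ball 0 1"] holomorphic_deriv)

text \<open>Both sides are the derivative of \<open>\<Phi> (P s t) = g s * g t\<close> in
  \<open>s\<close>, by the chain rule on the left. Since the identity holds near
  \<open>(s, t)\<close>, it can be differentiated again.\<close>

lemma first_order:
  assumes "(s, t) \<in> V"
  shows "A (P s t) - (1 - t) * B (P s t) = deriv g s * g t"
proof (rule DERIV_unique)
  show "((\<lambda>s. \<Phi> (P s t)) has_field_derivative A (P s t) - (1 - t) * B (P s t)) (at s)"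
    by (intro DERIV_compose_P derivative_\<Phi> V_imp_U assms)
  have "((\<lambda>s. g s * g t) has_field_derivative deriv g s * g t) (at s)"
    using assms by (auto intro!: derivative_eq_intros DERIV_g simp: V_def)
  then show "((\<lambda>s. \<Phi> (P s t)) has_field_derivative deriv g s * g t) (at s)"
    using eventually_mono[OF eventually_V(1)[OF assms], of "\<lambda>s'. \<Phi> (P s' t) = g s' * g t"]
    by (subst DERIV_cong_ev[OF refl _ refl]) (auto simp: V_def \<Phi>_eq)
qed

lemma second_order:
  assumes "(s, t) \<in> V"
  shows "AA (P s t) - (1 - t) * (AB (P s t) + BA (P s t)) + (1 - t)\<^sup>2 * BB (P s t) = deriv (deriv g) s * g t"
proof -
  have d1: "((\<lambda>s. A (P s t) - (1 - t) * B (P s t)) has_field_derivative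
     (AA (P s t) - (1 - t) * AB (P s t)) - (1 - t) * (BA (P s t) - (1 - t) * BB (P s t))) (at s)"
    by (intro DERIV_diff DERIV_cmult DERIV_compose_P derivative_A derivative_B V_imp_U assms)
  have d2: "((\<lambda>s. A (P s t) - (1 - t) * B (P s t)) has_field_derivative deriv (deriv g) s * g t) (at s)"
  proof -
    have "((\<lambda>s. deriv g s * g t) has_field_derivative deriv (deriv g) s * g t) (at s)"
      using assms by (auto intro!: derivative_eq_intros DERIV_g' simp: V_def)
    then show ?thesis
      using eventually_mono[OF eventually_V(1)[OF assms] first_order]
      by (subst DERIV_cong_ev[OF refl _ refl])
  qed
  show ?thesis
    unfolding DERIV_unique[OF d2 d1] by (simp add: algebra_simps power2_eq_square)
qed

text \<open>This is \<open>first_order\<close> differentiated in \<open>t\<close>; the isolated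
  \<open>B\<close> comes from the factor \<open>1 - t\<close>.\<close>

lemma mixed_order:
  assumes "(s, t) \<in> V"
  shows "AA (P s t) - (1 - s) * AB (P s t) + B (P s t) - (1 - t) * (BA (P s t) - (1 - s) * BB (P s t))
    = deriv g s * deriv g t"
proof -
  have d1: "((\<lambda>t. A (P s t) - (1 - t) * B (P s t)) has_field_derivative
     (AA (P s t) - (1 - s) * AB (P s t)) - ((1 - t) * (BA (P s t) - (1 - s) * BB (P s t)) + (0 - 1) * B (P s t))) (at t)"
    by (intro DERIV_diff DERIV_mult' DERIV_const DERIV_ident DERIV_compose_P derivative_A derivative_B V_imp_U assms)
  have d2: "((\<lambda>t. A (P s t) - (1 - t) * B (P s t)) has_field_derivative deriv g s * deriv g t) (at t)"
  proof -
    have "((\<lambda>t. deriv g s * g t) has_field_derivative deriv g s * deriv g t) (at t)"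
      using assms by (auto intro!: derivative_eq_intros DERIV_g simp: V_def)
    then show ?thesis
      using eventually_mono[OF eventually_V(2)[OF assms] first_order]
      by (subst DERIV_cong_ev[OF refl _ refl])
  qed
  show ?thesis
    unfolding DERIV_unique[OF d2 d1] by (simp add: algebra_simps)
qed

text \<open>Differentiating \<open>g s * g t\<close> in \<open>s\<close> then \<open>t\<close>, and in the opposite order, gives two expressions
  that differ by \<open>(t - s) * (AB - BA)\<close>.\<close>

lemma mixed_partials:
  assumes "(s, t) \<in> V" "s \<noteq> t"
  shows "AB (P s t) = BA (P s t)"
proof -
  have "(t - s) * (a - b) = 0"
    if "A - (1 - s) * a + B - (1 - t) * (b - (1 - s) * C) = u * v"
      "A - (1 - t) * a + B - (1 - s) * (b - (1 - t) * C) = v * u" for A B C a b u v :: complex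
    using that by algebra
  from this[OF mixed_order[OF assms(1)] mixed_order[OF assms(1)[unfolded V_swap[of s t]], unfolded P_swap[of t s]]] assms(2)
  show ?thesis
    by simp
qed

text \<open>The equations are kept free of denominators, so that their left sides are continuous on
  \<open>U\<close> and the diagonal can be reached as a limit.\<close>

lemma second_order_pdes:
  assumes ode: "\<And>t. norm t < 1 \<Longrightarrow>
      t * (1 - t)\<^sup>2 * deriv (deriv g) t + (1 - t)\<^sup>2 * deriv g t + (c - c\<^sup>2 * t - q * (1 - t)) * g t = 0"
    and xy: "(x, y) \<in> U" "(x, y) \<in> xy_domain"
  shows "(x + y + 1) * (A (x, y) + x * AA (x, y) + 2 * y * BA (x, y)) - A (x, y) + y * B (x, y)
      + (q - c) * \<Phi> (x, y) = 0"
    and "(x + y + 1) * (x * y * (B (x, y) + y * BB (x, y)) + 2 * y\<^sup>2 * BA (x, y)) + y\<^sup>2 * A (x, y)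
      + (y - x - x\<^sup>2) * y * B (x, y)
      - (c * (c - 1) * (x\<^sup>2 + x) + (c\<^sup>2 - q) * x * y - (q - c) * y) * \<Phi> (x, y) = 0"
proof -
  define L1 where "L1 = (\<lambda>(x, y). (x + y + 1) * (A (x, y) + x * AA (x, y) + 2 * y * BA (x, y)) - A (x, y)
      + y * B (x, y) + (q - c) * \<Phi> (x, y))"
  define L2 where "L2 = (\<lambda>(x, y). (x + y + 1) * (x * y * (B (x, y) + y * BB (x, y)) + 2 * y\<^sup>2 * BA (x, y))
      + y\<^sup>2 * A (x, y) + (y - x - x\<^sup>2) * y * B (x, y)
      - (c * (c - 1) * (x\<^sup>2 + x) + (c\<^sup>2 - q) * x * y - (q - c) * y) * \<Phi> (x, y))"
  obtain s t where P: "(x, y) = P s t" and st: "(s, t) \<in> V"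
    using xy unfolding xy_domain_def V_def by auto
  have off_diagonal: "L1 (P s t') = 0" "L2 (P s t') = 0" if "(s, t') \<in> V" "t' \<noteq> s" for t'
  proof -
    have V': "(t', s) \<in> V"
      using that V_swap by blast
    have n: "norm s < 1" "norm t' < 1" and U: "P s t' \<in> U"
      using that by (auto simp: V_def)
    \<comment> \<open>Off the diagonal \<open>AB\<close> is traded for \<open>BA\<close>, so that
      only coefficients of known continuity enter the limit.\<close>
    have M: "AB (P s t') = BA (P s t')"
      using mixed_partials that by blast
    have "\<Phi> (P s t') = g s * g t'"
      using \<Phi>_eq n U by blast
    then show "L1 (P s t') = 0" "L2 (P s t') = 0"
      unfolding L1_def L2_def prod.case
      using eliminate_second_derivatives[OF first_order[OF that(1)] first_order[OF V', unfolded P_swap[of t' s]]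
        second_order[OF that(1), unfolded M] second_order[OF V', unfolded P_swap[of t' s] M],
        of c q "s + t' - 2" "(1 - s) * (1 - t')"] ode[OF n(1)] ode[OF n(2)] that(2)
      by (auto simp: algebra_simps)
  qed
  have "isCont \<Phi> (P s t)" "isCont A (P s t)" "isCont B (P s t)"
    using xy P derivative_\<Phi> derivative_A derivative_B has_derivative_continuous by metis+
  moreover have "isCont AA (P s t)" "isCont BA (P s t)" "isCont BB (P s t)"
    using xy P continuous_second open_U by (auto simp: continuous_on_eq_continuous_at)
  ultimately have "isCont (\<lambda>t. \<Phi> (P s t)) t" "isCont (\<lambda>t. A (P s t)) t" "isCont (\<lambda>t. B (P s t)) t"
    "isCont (\<lambda>t. AA (P s t)) t" "isCont (\<lambda>t. BA (P s t)) t" "isCont (\<lambda>t. BB (P s t)) t"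
    by (auto intro!: isCont_o2[where f = "\<lambda>t. P s t"] continuous_intros)
  note cont' = this
  have cont: "isCont (\<lambda>t. L1 (P s t)) t" "isCont (\<lambda>t. L2 (P s t)) t"
    unfolding L1_def L2_def prod.case by (rule cont' continuous_intros)+
  \<comment> \<open>On the diagonal, \<open>s\<close> stays fixed and \<open>t'\<close> tends to
    \<open>s\<close> through values different from \<open>s\<close>, where the off-diagonal case
    applies.\<close>
  have vanish: "f t = 0" if "isCont f t" "\<And>t'. (s, t') \<in> V \<Longrightarrow> t' \<noteq> s \<Longrightarrow> f t' = 0" for f :: "complex \<Rightarrow> complex"
  proof (cases "t = s")
    case True
    have "eventually (\<lambda>t'. (s, t') \<in> V \<and> t' \<noteq> s) (at t)"
      using eventually_V(2)[OF st] True by (auto simp: eventually_at_filter elim: eventually_mono)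
    then have "eventually (\<lambda>t'. f t' = 0) (at t)"
      by eventually_elim (use that(2) in blast)
    then have "(f \<longlongrightarrow> 0) (at t)"
      by (rule tendsto_eventually)
    with that(1) show ?thesis
      unfolding isCont_def by (rule tendsto_unique[rotated]) simp
  qed (use that st in auto)
  have "L1 (x, y) = 0" "L2 (x, y) = 0"
    unfolding P using vanish[OF cont(1)] vanish[OF cont(2)] off_diagonal by blast+
  then show "(x + y + 1) * (A (x, y) + x * AA (x, y) + 2 * y * BA (x, y)) - A (x, y) + y * B (x, y)
      + (q - c) * \<Phi> (x, y) = 0"
    "(x + y + 1) * (x * y * (B (x, y) + y * BB (x, y)) + 2 * y\<^sup>2 * BA (x, y)) + y\<^sup>2 * A (x, y)
      + (y - x - x\<^sup>2) * y * B (x, y)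
      - (c * (c - 1) * (x\<^sup>2 + x) + (c\<^sup>2 - q) * x * y - (q - c) * y) * \<Phi> (x, y) = 0"
    unfolding L1_def L2_def by simp_all
qed

end

section \<open>Euler operators in terms of the jet\<close>

context symmetric_jet
begin

text \<open>The first-order formulas hold on a neighbourhood and may be substituted under the outer
  derivative. In \<open>Dx (Dy F)\<close> the \<open>y\<close> derivative is taken first, so the
  mixed coefficient is \<open>BA\<close>.\<close>

lemma euler_derivatives:
  fixes F
  assumes \<Phi>: "\<Phi> = (\<lambda>(x, y). F x y)" and xy: "(x, y) \<in> U"
  shows "Dx F x y = x * A (x, y)" "Dy F x y = y * B (x, y)"
    "Dx (Dx F) x y = x * (A (x, y) + x * AA (x, y))"
    "Dx (Dy F) x y = x * y * BA (x, y)"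
    "Dy (Dy F) x y = y * (B (x, y) + y * BB (x, y))"
proof -
  have first: "Dx F x y = x * A (x, y)" "Dy F x y = y * B (x, y)" if "(x, y) \<in> U" for x y
    using DERIV_partial[OF derivative_\<Phi>[OF that, unfolded \<Phi>]] by (simp_all add: Dx_def Dy_def DERIV_imp_deriv)
  show "Dx F x y = x * A (x, y)" "Dy F x y = y * B (x, y)"
    using first[OF xy] by auto
  note dA = DERIV_partial[of "curry A", unfolded curry_def case_prod_Pair_iden, simplified, OF derivative_A[OF xy]]
  note dB = DERIV_partial[of "curry B", unfolded curry_def case_prod_Pair_iden, simplified, OF derivative_B[OF xy]]
  note ev = eventually_section[OF open_U xy]
  have "((\<lambda>u. u * A (u, y)) has_field_derivative A (x, y) + x * AA (x, y)) (at x)"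
    "((\<lambda>u. y * B (u, y)) has_field_derivative y * BA (x, y)) (at x)"
    "((\<lambda>v. v * B (x, v)) has_field_derivative B (x, y) + y * BB (x, y)) (at y)"
    by (auto intro!: derivative_eq_intros dA dB)
  moreover have "deriv (\<lambda>u. Dx F u y) x = deriv (\<lambda>u. u * A (u, y)) x"
    by (rule deriv_cong_ev[OF eventually_mono[OF ev(1)] refl]) (rule first)
  moreover have "deriv (\<lambda>u. Dy F u y) x = deriv (\<lambda>u. y * B (u, y)) x"
    by (rule deriv_cong_ev[OF eventually_mono[OF ev(1)] refl]) (rule first)
  moreover have "deriv (\<lambda>v. Dy F x v) y = deriv (\<lambda>v. v * B (x, v)) y"
    by (rule deriv_cong_ev[OF eventually_mono[OF ev(2)] refl]) (rule first)
  ultimately show "Dx (Dx F) x y = x * (A (x, y) + x * AA (x, y))"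
    "Dx (Dy F) x y = x * y * BA (x, y)"
    "Dy (Dy F) x y = y * (B (x, y) + y * BB (x, y))"
    by (simp_all add: Dx_def[of "Dx F"] Dx_def[of "Dy F"] Dy_def[of "Dy F"] DERIV_imp_deriv)
qed

end

section \<open>Existence of the jet near every point of the domain\<close>

lemma xy_domain_cover:
  assumes "p \<in> xy_domain"
  obtains r where "0 < r" "r < 1" "p \<in> symmetric_image r"
proof -
  obtain t1 t2 where p: "p = (t1 + t2 - 2, (1 - t1) * (1 - t2))" and t: "norm t1 < 1" "norm t2 < 1"
    using assms by (auto simp: xy_domain_def)
  then obtain r where r: "max (norm t1) (norm t2) < r" "r < 1"
    using dense[of "max (norm t1) (norm t2)" 1] by auto
  show ?thesis
  proof (rule that[of r])
    show "0 < r"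
      using r norm_ge_zero[of t1] by linarith
    show "p \<in> symmetric_image r"
      using r p by (auto simp: symmetric_image_def)
  qed (rule r)
qed

text \<open>Three applications of \<open>kernel_algebra_derivative\<close>, to
  \<open>\<phi>\<close>, \<open>A\<close> and \<open>B\<close>, give all coefficients. The
  second-order ones are again in the class, hence differentiable and in particular
  continuous.\<close>

lemma symmetric_product_jet:
  assumes g: "g holomorphic_on ball 0 1" and p: "p \<in> xy_domain"
  obtains U A B AA AB BA BB where "p \<in> U"
    "symmetric_jet g U (\<lambda>(x, y). symmetric_product g x y) A B AA AB BA BB"
proof -
  obtain r where r: "0 < r" "r < 1" "p \<in> symmetric_image r"
    using xy_domain_cover[OF p] by blast
  obtain z \<phi> where K: "quadratic_kernel z (symmetric_image r)" and \<phi>: "quadratic_kernel.kernel_algebra z \<phi>"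
    and \<phi>_eq: "\<And>t1 t2. norm t1 < r \<Longrightarrow> norm t2 < r \<Longrightarrow> \<phi> (t1 + t2 - 2, (1 - t1) * (1 - t2)) = g t1 * g t2"
    by (rule symmetric_product_kernel_algebra[OF g r(1,2)]) (rule that)
  interpret quadratic_kernel z "symmetric_image r"
    by (rule K)
  obtain A B where A: "kernel_algebra A" and B: "kernel_algebra B"
    and d\<phi>: "\<And>p. p \<in> symmetric_image r \<Longrightarrow> (\<phi> has_derivative (\<lambda>(u, v). A p * u + B p * v)) (at p)"
    by (rule kernel_algebra_derivative[OF \<phi>]) (rule that)
  obtain AA AB where AA: "kernel_algebra AA" and AB: "kernel_algebra AB"
    and dA: "\<And>p. p \<in> symmetric_image r \<Longrightarrow> (A has_derivative (\<lambda>(u, v). AA p * u + AB p * v)) (at p)"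
    by (rule kernel_algebra_derivative[OF A]) (rule that)
  obtain BA BB where BA: "kernel_algebra BA" and BB: "kernel_algebra BB"
    and dB: "\<And>p. p \<in> symmetric_image r \<Longrightarrow> (B has_derivative (\<lambda>(u, v). BA p * u + BB p * v)) (at p)"
    by (rule kernel_algebra_derivative[OF B]) (rule that)
  have cont: "continuous_on (symmetric_image r) \<psi>" if \<psi>: "kernel_algebra \<psi>" for \<psi>
  proof -
    obtain C D where "\<And>p. p \<in> symmetric_image r \<Longrightarrow> (\<psi> has_derivative (\<lambda>(u, v). C p * u + D p * v)) (at p)"
      by (rule kernel_algebra_derivative[OF \<psi>]) (rule that)
    then show ?thesis
      by (intro continuous_at_imp_continuous_on ballI has_derivative_continuous)
  qed
  have eq: "\<phi> q = (\<lambda>(x, y). symmetric_product g x y) q" if q: "q \<in> symmetric_image r" for q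
    using q \<phi>_eq unfolding symmetric_image_def by (auto simp: symmetric_product_eq)
  have "symmetric_jet g (symmetric_image r) (\<lambda>(x, y). symmetric_product g x y) A B AA AB BA BB"
  proof
    fix q assume q: "q \<in> symmetric_image r"
    show "((\<lambda>(x, y). symmetric_product g x y) has_derivative (\<lambda>(u, v). A q * u + B q * v)) (at q)"
      by (rule has_derivative_transform_within_open[OF d\<phi>[OF q] open_U q eq])
  qed (simp_all add: symmetric_product_eq g open_U cont AA BA BB dA dB)
  with r(3) show ?thesis
    by (rule that)
qed

subsection \<open>The hypergeometric factor\<close>

definition twisted_2F1 :: "real \<Rightarrow> real \<Rightarrow> complex \<Rightarrow> complex" where
  "twisted_2F1 a b t = gauss_2F1 (of_real a) (of_real b) 1 t * (1 - t) powr of_real ((a + b) / 2)"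

lemma F_prod_eq: "F_prod a b t1 t2 = twisted_2F1 a b t1 * twisted_2F1 a b t2"
  by (simp add: F_prod_def twisted_2F1_def)

lemma holomorphic_gauss_2F1:
  assumes "0 < a" "a < 1" "0 < b" "b < 1"
  shows "gauss_2F1 (complex_of_real a) (of_real b) 1 holomorphic_on ball 0 1"
proof -
  have "ball (0 :: complex) 1 \<subseteq> eball 0 (fps_conv_radius (fps_hypergeo [complex_of_real a, of_real b] [1] 1))"
    using gauss_2F1_conv_radius[OF assms] by (intro ball_eball_mono) (simp add: one_ereal_def)
  then show ?thesis
    unfolding gauss_2F1_def by (intro holomorphic_intros) auto
qed

text \<open>Keeps \<open>1 - t\<close> off the branch cut of \<open>powr\<close>: its real part is
  positive.\<close>

lemma one_minus_notin_nonpos_Reals: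
  assumes "norm (t :: complex) < 1"
  shows "1 - t \<notin> \<real>\<^sub>\<le>\<^sub>0" "1 - t \<noteq> 0"
proof -
  have "Re t < 1"
    using assms complex_Re_le_cmod[of t] by linarith
  then show "1 - t \<notin> \<real>\<^sub>\<le>\<^sub>0" "1 - t \<noteq> 0"
    by (auto simp: complex_nonpos_Reals_iff complex_eq_iff)
qed

lemma holomorphic_twisted_2F1:
  assumes "0 < a" "a < 1" "0 < b" "b < 1"
  shows "twisted_2F1 a b holomorphic_on ball 0 1"
  unfolding twisted_2F1_def using one_minus_notin_nonpos_Reals
  by (intro holomorphic_intros holomorphic_gauss_2F1 assms) auto

text \<open>The left side is \<open>(1 - t) powr c * (1 - t)\<close> times Gauss's operator applied
  to the hypergeometric function; the sum of the parameters enters as \<open>2 * c\<close>.\<close>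

lemma twisted_2F1_ode:
  fixes a b :: real
  defines "g \<equiv> twisted_2F1 a b" and "c \<equiv> complex_of_real ((a + b) / 2)"
  assumes ab: "0 < a" "a < 1" "0 < b" "b < 1" and t: "norm t < 1"
  shows "t * (1 - t)\<^sup>2 * deriv (deriv g) t + (1 - t)\<^sup>2 * deriv g t
    + (c - c\<^sup>2 * t - of_real (a * b) * (1 - t)) * g t = 0"
proof -
  define f where "f = gauss_2F1 (complex_of_real a) (of_real b) 1"
  define p where "p t = (1 - t) powr c" for t :: complex
  have dp: "(p has_field_derivative - c * p t / (1 - t)) (at t)" if "norm t < 1" for t
    unfolding p_def using one_minus_notin_nonpos_Reals[OF that]
    by (auto intro!: derivative_eq_intros simp: powr_diff)
  have f: "f holomorphic_on ball 0 1"
    unfolding f_def by (rule holomorphic_gauss_2F1[OF ab])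
  have df: "(f has_field_derivative deriv f t) (at t)"
    "(deriv f has_field_derivative deriv (deriv f) t) (at t)" if "norm t < 1" for t
    using that f by (auto intro!: holomorphic_derivI[of _ "ball 0 1"] holomorphic_deriv)
  define g1 where "g1 t = p t * (deriv f t - c * f t / (1 - t))" for t
  have g: "g t = f t * p t" for t
    by (simp add: g_def twisted_2F1_def f_def p_def c_def)
  have "(g has_field_derivative g1 t) (at t)" if "norm t < 1" for t
    unfolding g [abs_def] g1_def using one_minus_notin_nonpos_Reals(2)[OF that]
    by (auto intro!: derivative_eq_intros dp df that simp: field_simps)
  then have dg: "deriv g t = g1 t" if "norm t < 1" for t
    using that by (auto intro: DERIV_imp_deriv)
  define g2 where "g2 = p t * (deriv (deriv f) t - c * deriv f t / (1 - t) - c * f t / (1 - t)\<^sup>2)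
      - c * p t / (1 - t) * (deriv f t - c * f t / (1 - t))"
  have s: "1 - t \<noteq> 0"
    using one_minus_notin_nonpos_Reals(2)[OF t] .
  \<comment> \<open>With \<open>i\<close> as a symbol subject only to
    \<open>(1 - t) * i = 1\<close>, the rational identities below become polynomial ones.\<close>
  define i where "i = inverse (1 - t)"
  have i: "(1 - t) * i = 1"
    using s by (simp add: i_def)
  have "(g1 has_field_derivative - c * p t / (1 - t) * (deriv f t - c * f t / (1 - t))
      + (deriv (deriv f) t - (c * deriv f t * (1 - t) - c * f t * (0 - 1)) / ((1 - t) * (1 - t))) * p t) (at t)"
    unfolding g1_def [abs_def]
    by (intro DERIV_mult DERIV_diff DERIV_divide DERIV_cmult DERIV_const DERIV_ident dp df t s)
  also have "- c * p t / (1 - t) * (deriv f t - c * f t / (1 - t))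
      + (deriv (deriv f) t - (c * deriv f t * (1 - t) - c * f t * (0 - 1)) / ((1 - t) * (1 - t))) * p t = g2"
  proof -
    have "- c * p t * i * (D1 - c * D0 * i) + (D2 - (c * D1 * (1 - t) - c * D0 * (0 - 1)) * (i * i)) * p t
      = p t * (D2 - c * D1 * i - c * D0 * i\<^sup>2) - c * p t * i * (D1 - c * D0 * i)" for D0 D1 D2
      using i by algebra
    then show ?thesis
      by (simp only: g2_def i_def divide_inverse inverse_mult_distrib power_inverse)
  qed
  finally have "(g1 has_field_derivative g2) (at t)" .
  \<comment> \<open>The second derivative needs the formula for the first one near \<open>t\<close>,
    not only at \<open>t\<close>.\<close>
  moreover have "eventually (\<lambda>u. deriv g u = g1 u) (nhds t)"
    using eventually_nhds_in_open[of "ball 0 1" t] t by (auto elim!: eventually_mono simp: dg)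
  ultimately have ddg: "deriv (deriv g) t = g2"
    by (metis DERIV_imp_deriv deriv_cong_ev)
  define q where "q = complex_of_real (a * b)"
  have ode: "t * (1 - t) * deriv (deriv f) t + (1 - (1 + 2 * c) * t) * deriv f t - q * f t = 0"
    using gauss_2F1_ode[OF ab t, folded f_def] by (simp add: c_def q_def add.assoc add_divide_distrib)
  have "t * (1 - t)\<^sup>2 * deriv (deriv g) t + (1 - t)\<^sup>2 * deriv g t + (c - c\<^sup>2 * t - q * (1 - t)) * g t
    = p t * (1 - t) * (t * (1 - t) * deriv (deriv f) t + (1 - (1 + 2 * c) * t) * deriv f t - q * f t)"
  proof -
    \<comment> \<open>\<open>D0\<close>, \<open>D1\<close>, \<open>D2\<close> stand for
      \<open>f t\<close> and its first two derivatives, treated as indeterminates.\<close>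
    have "t * (1 - t)\<^sup>2 * (p t * (D2 - c * D1 * i - c * D0 * i\<^sup>2) - c * p t * i * (D1 - c * D0 * i))
      + (1 - t)\<^sup>2 * (p t * (D1 - c * D0 * i)) + (c - c\<^sup>2 * t - q * (1 - t)) * (D0 * p t)
      = p t * (1 - t) * (t * (1 - t) * D2 + (1 - (1 + 2 * c) * t) * D1 - q * D0)" for D0 D1 D2
      using i by algebra
    then show ?thesis
      unfolding ddg dg[OF t] g g1_def g2_def by (simp add: i_def divide_inverse power_inverse)
  qed
  then show ?thesis
    unfolding ode by (simp add: q_def)
qed

section \<open>The two differential equations for the product\<close>

theorem theorem5p1:
  fixes a b :: real
  assumes "0 < a" "a < 1" "0 < b" "b < 1"
  shows "\<exists>F :: complex \<Rightarrow> complex \<Rightarrow> complex.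
    (\<forall>t1 t2. norm t1 < 1 \<longrightarrow> norm t2 < 1 \<longrightarrow>
       F (t1 + t2 - 2) ((1 - t1) * (1 - t2)) = F_prod a b t1 t2) \<and>
    holomorphic2_on F xy_domain \<and>
    (\<forall>x y. (x, y) \<in> xy_domain \<longrightarrow> x + y + 1 \<noteq> 0 \<longrightarrow>
       Dx (Dx F) x y + 2 * Dx (Dy F) x y
         - 1 / (x + y + 1) * Dx F x y
         + x / (x + y + 1) * Dy F x y
         + of_real (2 * a * b - a - b) * x / (2 * (x + y + 1)) * F x y = 0 \<and>
       Dy (Dy F) x y + 2 * y / x\<^sup>2 * Dx (Dy F) x y
         + y\<^sup>2 / (x\<^sup>2 * (x + y + 1)) * Dx F x y
         + (y - x - x\<^sup>2) / (x * (x + y + 1)) * Dy F x y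
         - (of_real ((a + b) * (a + b - 2)) * (x\<^sup>2 + x) + of_real ((a - b)\<^sup>2) * x * y
              - of_real (4 * a * b - 2 * a - 2 * b) * y)
             / (4 * x * (x + y + 1)) * F x y = 0)"
proof -
  define g where "g = twisted_2F1 a b"
  define F where "F = symmetric_product g"
  have g: "g holomorphic_on ball 0 1"
    unfolding g_def by (rule holomorphic_twisted_2F1[OF assms])
  show ?thesis
  proof (intro exI[of _ F] conjI allI impI)
    fix t1 t2
    show "F (t1 + t2 - 2) ((1 - t1) * (1 - t2)) = F_prod a b t1 t2"
      by (simp add: F_def symmetric_product_eq F_prod_eq g_def)
  next
    show "holomorphic2_on F xy_domain"
      unfolding holomorphic2_on_def
    proof
      fix p assume p: "p \<in> xy_domain"
      obtain U A B AA AB BA BB where U: "p \<in> U" and jet: "symmetric_jet g U (\<lambda>(x, y). F x y) A B AA AB BA BB"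
        unfolding F_def by (rule symmetric_product_jet[OF g p])
      show "\<exists>A B. ((\<lambda>(x, y). F x y) has_derivative (\<lambda>(h, k). A * h + B * k)) (at p)"
        using symmetric_jet.derivative_\<Phi>[OF jet U] by blast
    qed
  next
    fix x y assume xy: "(x, y) \<in> xy_domain" and T: "x + y + 1 \<noteq> 0"
    obtain U A B AA AB BA BB where U: "(x, y) \<in> U" and jet: "symmetric_jet g U (\<lambda>(x, y). F x y) A B AA AB BA BB"
      unfolding F_def by (rule symmetric_product_jet[OF g xy])
    interpret symmetric_jet g U "\<lambda>(x, y). F x y" A B AA AB BA BB
      by (rule jet)
    \<comment> \<open>Two points of the open unit disc cannot have sum \<open>2\<close>.\<close>
    have x: "x \<noteq> 0"
    proof
      assume "x = 0"
      then obtain t1 t2 :: complex where t: "t1 + t2 = 2" "norm t1 < 1" "norm t2 < 1"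
        using xy by (auto simp: xy_domain_def)
      then show False
        using norm_triangle_ineq[of t1 t2] by simp
    qed
    define T' where "T' = x + y + 1"
    have T': "T' \<noteq> 0"
      using T by (simp add: T'_def)
    define c q where "c = complex_of_real ((a + b) / 2)" and "q = complex_of_real (a * b)"
    have pdes:
      "(x + y + 1) * (A (x, y) + x * AA (x, y) + 2 * y * BA (x, y)) - A (x, y) + y * B (x, y)
        + (q - c) * F x y = 0"
      "(x + y + 1) * (x * y * (B (x, y) + y * BB (x, y)) + 2 * y\<^sup>2 * BA (x, y)) + y\<^sup>2 * A (x, y)
        + (y - x - x\<^sup>2) * y * B (x, y)
        - (c * (c - 1) * (x\<^sup>2 + x) + (c\<^sup>2 - q) * x * y - (q - c) * y) * F x y = 0"
      using second_order_pdes[OF twisted_2F1_ode[OF assms, folded g_def] U xy]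
      unfolding c_def q_def prod.case by blast+
    note D = euler_derivatives[OF refl U]
    \<comment> \<open>All coefficients are symmetric in \<open>a\<close> and \<open>b\<close>, hence
      polynomials in the half sum \<open>c\<close> and the product \<open>q\<close>.\<close>
    have coeffs: "of_real (2 * a * b - a - b) = 2 * (q - c)" "of_real ((a + b) * (a + b - 2)) = 4 * (c * (c - 1))"
      "of_real ((a - b)\<^sup>2) = 4 * (c\<^sup>2 - q)" "of_real (4 * a * b - 2 * a - 2 * b) = 4 * (q - c)"
      by (simp_all add: c_def q_def field_simps power2_eq_square)
    \<comment> \<open>The first equation is the first polynomial relation times
      \<open>x / (x + y + 1)\<close>.\<close>
    have "Dx (Dx F) x y + 2 * Dx (Dy F) x y - 1 / (x + y + 1) * Dx F x y + x / (x + y + 1) * Dy F x y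
        + of_real (2 * a * b - a - b) * x / (2 * (x + y + 1)) * F x y
      = x / (x + y + 1) * ((x + y + 1) * (A (x, y) + x * AA (x, y) + 2 * y * BA (x, y)) - A (x, y) + y * B (x, y)
        + (q - c) * F x y)"
      unfolding D coeffs T'_def[symmetric] using T' by (simp add: divide_simps) (simp add: algebra_simps)
    also have "\<dots> = 0"
      unfolding pdes by simp
    finally show "Dx (Dx F) x y + 2 * Dx (Dy F) x y - 1 / (x + y + 1) * Dx F x y + x / (x + y + 1) * Dy F x y
        + of_real (2 * a * b - a - b) * x / (2 * (x + y + 1)) * F x y = 0" .
    \<comment> \<open>The second is the second relation divided by
      \<open>x * (x + y + 1)\<close>.\<close>
    have "Dy (Dy F) x y + 2 * y / x\<^sup>2 * Dx (Dy F) x y + y\<^sup>2 / (x\<^sup>2 * (x + y + 1)) * Dx F x y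
         + (y - x - x\<^sup>2) / (x * (x + y + 1)) * Dy F x y
         - (of_real ((a + b) * (a + b - 2)) * (x\<^sup>2 + x) + of_real ((a - b)\<^sup>2) * x * y
              - of_real (4 * a * b - 2 * a - 2 * b) * y)
             / (4 * x * (x + y + 1)) * F x y
      = 1 / (x * (x + y + 1)) * ((x + y + 1) * (x * y * (B (x, y) + y * BB (x, y)) + 2 * y\<^sup>2 * BA (x, y))
        + y\<^sup>2 * A (x, y) + (y - x - x\<^sup>2) * y * B (x, y)
        - (c * (c - 1) * (x\<^sup>2 + x) + (c\<^sup>2 - q) * x * y - (q - c) * y) * F x y)"
      unfolding D coeffs T'_def[symmetric] using T' x by (simp add: divide_simps) (simp add: algebra_simps power2_eq_square)
    also have "\<dots> = 0"
      unfolding pdes by simp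
    finally show "Dy (Dy F) x y + 2 * y / x\<^sup>2 * Dx (Dy F) x y + y\<^sup>2 / (x\<^sup>2 * (x + y + 1)) * Dx F x y
         + (y - x - x\<^sup>2) / (x * (x + y + 1)) * Dy F x y
         - (of_real ((a + b) * (a + b - 2)) * (x\<^sup>2 + x) + of_real ((a - b)\<^sup>2) * x * y
              - of_real (4 * a * b - 2 * a - 2 * b) * y)
             / (4 * x * (x + y + 1)) * F x y = 0" .
  qed
qed

end
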